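(* Let $n\in\mathbb N$ and let $A,B\in C(\mathbb R,\mathbb R^{n\times n})$. Let $X(t)$ be the fundamental matrix solution of $x'=A(t)x$ with $X(0)=I$, and put $P(t)=X^{-1}(t)B(t)X(t)$. Suppose that $$\int_0^\infty \|P(t)\|\,dt<\infty .$$ Let $\Psi(t)$ be a solution of $\Psi'=P(t)(\Psi+I)$ satisfying $\Psi(t)\to 0$ as $t\to\infty$, and suppose that $\lim_{t\to\infty}X(t)\Psi(t)=0$. Suppose moreover that the system $x'=A(t)x$ has a $k$-parameter ($k\le n$) family $\sigma_2$ of almost periodic solutions. Then there exists a $k$-parameter family $\sigma_1$ of asymptotically almost periodic solutions of $y'=[A(t)+B(t)]y$, and $\sigma_1$ is isomorphic to $\sigma_2$.
   Context: $\|\cdot\|$ is the Euclidean norm on $\mathbb R^n$ (and a corresponding matrix norm); $C(\mathbb X,\mathbb Y)$ is the set of continuous functions from $\mathbb X$ to $\mathbb Y$. Under the integrability condition on $P$, a solution $\Psi$ of $\Psi'=P(t)(\Psi+I)$ with $\Psi(t)\to0$ as $t\to\infty$ exists (a known lemma of Ráb). A function $f\in C(\mathbb R,\mathbb R^n)$ is almost periodic if for every $\epsilon>0$ the set of $\tau\in\mathbb R$ with $\|f(t+\tau)-f(t)\|<\epsilon$ for all $t\in\mathbb R$ is relatively dense. A function $f\in C(\mathbb R,\mathbb R^n)$ is asymptotically almost periodic if $f=g+\phi$ with $g$ almost periodic and $\phi\in C(\mathbb R,\mathbb R^n)$, $\lim_{t\to\infty}\phi(t)=0$. A $k$-parameter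 family of solutions of a linear homogeneous system means a $k$-dimensional linear subspace of its solution space, and isomorphic means linearly isomorphic. *)

theory Defs
  imports "HOL-Analysis.Analysis" "HOL-Library.Function_Algebras"
begin

definition solves_linear_system :: "(real \<Rightarrow> real^'n^'n) \<Rightarrow> (real \<Rightarrow> real^'n) \<Rightarrow> bool" where
  "solves_linear_system A x \<longleftrightarrow> (\<forall>t. (x has_vector_derivative A t *v x t) (at t))"

text \<open>Normalised at 0. For continuous \<open>A\<close>, invertibility of every \<open>X t\<close> is a consequence of
  \<open>X 0 = mat 1\<close>, so it is not part of the definition.\<close>

definition fundamental_matrix :: "(real \<Rightarrow> real^'n^'n) \<Rightarrow> (real \<Rightarrow> real^'n^'n) \<Rightarrow> bool" where
  "fundamental_matrix A X \<longleftrightarrow>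
     (\<forall>t. (X has_vector_derivative A t ** X t) (at t)) \<and> X 0 = mat 1"

definition relatively_dense :: "real set \<Rightarrow> bool" where
  "relatively_dense S \<longleftrightarrow> (\<exists>L>0. \<forall>a. S \<inter> {a..a + L} \<noteq> {})"

definition almost_periodic :: "(real \<Rightarrow> real^'n) \<Rightarrow> bool" where
  "almost_periodic f \<longleftrightarrow> continuous_on UNIV f \<and>
     (\<forall>\<epsilon>>0. relatively_dense {\<tau>. \<forall>t. norm (f (t + \<tau>) - f t) < \<epsilon>})"

definition asymptotically_almost_periodic :: "(real \<Rightarrow> real^'n) \<Rightarrow> bool" where
  "asymptotically_almost_periodic f \<longleftrightarrow> continuous_on UNIV f \<and>
     (\<exists>g \<phi>. almost_periodic g \<and> continuous_on UNIV \<phi> \<and> (\<phi> \<longlongrightarrow> 0) at_top \<and>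
            (\<forall>t. f t = g t + \<phi> t))"

text \<open>Functions with pointwise operations as a real vector space. The library provides the
  pointwise additive group but no \<open>real_vector\<close> instance for functions, so the scaling is
  passed explicitly to the locale \<^locale>\<open>vector_space\<close>.\<close>

definition fun_scale :: "real \<Rightarrow> (real \<Rightarrow> real^'n) \<Rightarrow> real \<Rightarrow> real^'n" where
  "fun_scale c f = (\<lambda>t. c *\<^sub>R f t)"

interpretation fun_space: vector_space fun_scale
  by unfold_locales (auto simp: fun_scale_def fun_eq_iff algebra_simps)

text \<open>A \<open>k\<close>-dimensional linear subspace is described by a finite basis rather than by
  \<open>fun_space.dim\<close>, because the latter is \<open>0\<close> on infinite-dimensional subspaces.\<close>

definition k_dim_subspace :: "nat \<Rightarrow> (real \<Rightarrow> real^'n) set \<Rightarrow> bool" where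
  "k_dim_subspace k V \<longleftrightarrow>
     (\<exists>b. finite b \<and> card b = k \<and> fun_space.independent b \<and> fun_space.span b = V)"

definition k_parameter_family ::
    "nat \<Rightarrow> (real \<Rightarrow> real^'n^'n) \<Rightarrow> (real \<Rightarrow> real^'n) set \<Rightarrow> bool" where
  "k_parameter_family k A V \<longleftrightarrow>
     k_dim_subspace k V \<and> (\<forall>x\<in>V. solves_linear_system A x)"

definition linearly_isomorphic ::
    "(real \<Rightarrow> real^'n) set \<Rightarrow> (real \<Rightarrow> real^'n) set \<Rightarrow> bool" where
  "linearly_isomorphic V W \<longleftrightarrow>
     (\<exists>T. bij_betw T V W \<and>
          (\<forall>x\<in>V. \<forall>y\<in>V. T (x + y) = T x + T y) \<and>
          (\<forall>c. \<forall>x\<in>V. T (fun_scale c x) = fun_scale c (T x)))"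

end

theory Submission
  imports Defs
begin

text \<open>
  Put \<open>Y t = X t ** (mat 1 + \<Psi> t)\<close>. Since \<open>X P = B X\<close>, the product rule turns the equation for
  \<open>\<Psi>\<close> into \<open>Y' = (A + B) Y\<close>, so every \<open>Y t *v c\<close> with constant \<open>c\<close> solves the perturbed system.
  A solution of the unperturbed system is \<open>x t = X t *v x 0\<close>, and the solution
  \<open>Y t *v x 0 = x t + X t ** \<Psi> t *v x 0\<close> of the perturbed one differs from it by a function that
  tends to \<open>0\<close>, because \<open>X t ** \<Psi> t\<close> does. Hence the linear map
  \<open>T x = (\<lambda>t. Y t *v x 0)\<close> sends almost periodic solutions to asymptotically almost periodic ones.
  It is injective on solutions: if \<open>Y t *v x 0\<close> vanishes identically, then, \<open>X t\<close> being injective,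
  \<open>x 0 + \<Psi> t *v x 0 = 0\<close> for all \<open>t\<close>, and letting \<open>t\<close> tend to infinity gives \<open>x 0 = 0\<close>. So
  \<open>\<sigma>\<^sub>1 = T ` \<sigma>\<^sub>2\<close> has the required dimension, and the inverse of \<open>T\<close> is the isomorphism.

  Both the formula \<open>x t = X t *v x 0\<close> and the injectivity of \<open>X t\<close> come from uniqueness for the
  initial value problem (\<open>solves_linear_system_eq_zero\<close>), which is proved by an energy estimate.
\<close>

lemma bounded_bilinear_matrix_vector_mult:
  "bounded_bilinear ((*v) :: real^'n^'m \<Rightarrow> real^'n \<Rightarrow> real^'m)"
  unfolding bilinear_conv_bounded_bilinear [symmetric] bilinear_def
  by (auto intro!: linearI simp: matrix_vector_right_distrib matrix_vector_mult_add_rdistrib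
      matrix_vector_mult_scaleR scaleR_matrix_vector_assoc [symmetric])

lemma bounded_bilinear_matrix_matrix_mult:
  "bounded_bilinear ((**) :: real^'n^'m \<Rightarrow> real^'p^'n \<Rightarrow> real^'p^'m)"
  unfolding bilinear_conv_bounded_bilinear [symmetric] bilinear_def
  by (auto intro!: linearI simp: matrix_matrix_mult_def vec_eq_iff
      distrib_left distrib_right sum.distrib sum_distrib_left mult_ac)

text \<open>On the compact interval from \<open>s\<close> to \<open>t\<close> the matrices \<open>A r\<close> are bounded, so the derivative of
  \<open>x r \<bullet> x r\<close> is at most \<open>L * (x r \<bullet> x r)\<close> for some constant \<open>L\<close>. Hence
  \<open>(x r \<bullet> x r) * exp (- L * r)\<close> is nonincreasing; it starts at \<open>0\<close> and is nonnegative.\<close>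

lemma linear_ode_eq_zero_forward:
  fixes A :: "real \<Rightarrow> real^'n^'n" and x :: "real \<Rightarrow> real^'n"
  assumes A: "continuous_on UNIV A" and x: "solves_linear_system A x"
    and "x s = 0" and "s \<le> t"
  shows "x t = 0"
proof -
  obtain K where K: "K > 0" "\<And>M v. norm ((M :: real^'n^'n) *v (v :: real^'n)) \<le> norm M * norm v * K"
    using bounded_bilinear.pos_bounded [OF bounded_bilinear_matrix_vector_mult] by blast
  have "compact (A ` {s..t})"
    by (rule compact_continuous_image [OF continuous_on_subset [OF A]]) auto
  then obtain C where C: "\<And>r. r \<in> {s..t} \<Longrightarrow> norm (A r) \<le> C"
    by (meson bounded_iff compact_imp_bounded imageI)
  define L where "L = 2 * C * K"
  define u where "u r = (x r \<bullet> x r) * exp (- L * r)" for r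
  have "u t \<le> u s"
  proof (rule DERIV_nonpos_imp_nonincreasing [OF \<open>s \<le> t\<close>])
    fix r assume r: "s \<le> r" "r \<le> t"
    have "(x has_derivative (\<lambda>h. h *\<^sub>R (A r *v x r))) (at r)"
      using x by (simp add: solves_linear_system_def has_vector_derivative_def)
    then have "((\<lambda>r. x r \<bullet> x r) has_real_derivative 2 * (x r \<bullet> (A r *v x r))) (at r)"
      unfolding has_field_derivative_def
      by (auto intro!: derivative_eq_intros simp: fun_eq_iff inner_commute)
    then have u': "(u has_real_derivative
        (2 * (x r \<bullet> (A r *v x r)) - L * (x r \<bullet> x r)) * exp (- L * r)) (at r)"
      unfolding u_def by (auto intro!: derivative_eq_intros simp: algebra_simps)
    have "x r \<bullet> (A r *v x r) \<le> norm (x r) * norm (A r *v x r)"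
      by (rule norm_cauchy_schwarz)
    also have "\<dots> \<le> norm (x r) * (norm (A r) * norm (x r) * K)"
      by (intro mult_left_mono K) auto
    also have "\<dots> \<le> norm (x r) * (C * norm (x r) * K)"
      using C [of r] r K(1) by (intro mult_left_mono mult_right_mono) auto
    also have "\<dots> = C * K * (x r \<bullet> x r)"
      by (simp add: power2_norm_eq_inner [symmetric] power2_eq_square)
    finally have "2 * (x r \<bullet> (A r *v x r)) - L * (x r \<bullet> x r) \<le> 0"
      by (simp add: L_def)
    with u' show "\<exists>y. (u has_real_derivative y) (at r) \<and> y \<le> 0"
      by (meson exp_ge_zero mult_nonpos_nonneg)
  qed
  then have "(x t \<bullet> x t) * exp (- L * t) \<le> 0"
    using \<open>x s = 0\<close> by (simp add: u_def)
  then show ?thesis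
    by (simp add: mult_le_0_iff) (meson inner_gt_zero_iff not_le)
qed

text \<open>Times before \<open>s\<close> are reached by running the system backwards.\<close>

lemma solves_linear_system_eq_zero:
  fixes A :: "real \<Rightarrow> real^'n^'n" and x :: "real \<Rightarrow> real^'n"
  assumes A: "continuous_on UNIV A" and x: "solves_linear_system A x" and "x s = 0"
  shows "x t = 0"
proof (cases "s \<le> t")
  case True
  then show ?thesis
    using linear_ode_eq_zero_forward assms by blast
next
  case False
  have "((\<lambda>r. x (- r)) has_vector_derivative - A (- r) *v x (- r)) (at r)" for r
  proof -
    have "((x \<circ> uminus) has_vector_derivative (- 1) *\<^sub>R (A (- r) *v x (- r))) (at r)"
      by (rule vector_diff_chain_at)
        (use x in \<open>auto simp: solves_linear_system_def intro!: derivative_eq_intros\<close>)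
    then show ?thesis
      by (simp add: o_def bounded_bilinear.minus_left [OF bounded_bilinear_matrix_vector_mult])
  qed
  then have rev: "solves_linear_system (\<lambda>r. - A (- r)) (\<lambda>r. x (- r))"
    by (simp add: solves_linear_system_def)
  have "continuous_on UNIV (\<lambda>r. - A (- r))"
    by (intro continuous_intros continuous_on_compose2 [OF A]) auto
  from linear_ode_eq_zero_forward [OF this rev, of "- s" "- t"] have "x (- (- t)) = 0"
    using False \<open>x s = 0\<close> by simp
  then show ?thesis
    by simp
qed

lemma solves_linear_system_matrix_mult:
  fixes A Y :: "real \<Rightarrow> real^'n^'n"
  assumes "\<And>t. (Y has_vector_derivative A t ** Y t) (at t)"
  shows "solves_linear_system A (\<lambda>t. Y t *v c)"
  unfolding solves_linear_system_def
  using bounded_linear.has_vector_derivative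
    [OF bounded_bilinear.bounded_linear_left [OF bounded_bilinear_matrix_vector_mult] assms]
  by (simp add: matrix_vector_mul_assoc)

text \<open>A solution \<open>X t *v v\<close> that vanishes at one time vanishes at time \<open>0\<close>, where it equals \<open>v\<close>.\<close>

lemma fundamental_matrix_mult_eq_zero_iff:
  assumes A: "continuous_on UNIV A" and X: "fundamental_matrix A X"
  shows "X t *v v = 0 \<longleftrightarrow> v = 0"
proof
  assume "X t *v v = 0"
  moreover have "solves_linear_system A (\<lambda>t. X t *v v)"
    using X by (intro solves_linear_system_matrix_mult) (simp add: fundamental_matrix_def)
  ultimately have "X 0 *v v = 0"
    using solves_linear_system_eq_zero [OF A] by blast
  then show "v = 0"
    using X by (simp add: fundamental_matrix_def)
qed simp

lemma fundamental_matrix_inverse: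
  assumes A: "continuous_on UNIV A" and X: "fundamental_matrix A X"
  shows "X t ** matrix_inv (X t) = mat 1"
proof -
  have "invertible (X t)"
    unfolding invertible_left_inverse matrix_left_invertible_ker
    using fundamental_matrix_mult_eq_zero_iff [OF A X] by blast
  then show ?thesis
    unfolding invertible_def matrix_inv_def by (rule someI2_ex) simp
qed

lemma solution_eq_fundamental_matrix_mult:
  assumes A: "continuous_on UNIV A" and X: "fundamental_matrix A X"
    and x: "solves_linear_system A x"
  shows "x t = X t *v x 0"
proof -
  have "solves_linear_system A (\<lambda>t. X t *v x 0)"
    using X by (intro solves_linear_system_matrix_mult) (simp add: fundamental_matrix_def)
  then have "solves_linear_system A (\<lambda>t. x t - X t *v x 0)"
    using x by (auto simp: solves_linear_system_def matrix_vector_mult_diff_distrib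
        intro!: has_vector_derivative_diff)
  then have "x t - X t *v x 0 = 0"
    by (rule solves_linear_system_eq_zero [OF A, where s = 0])
      (use X in \<open>simp add: fundamental_matrix_def\<close>)
  then show ?thesis
    by simp
qed

text \<open>Variation of constants: the equation for \<open>\<Psi>\<close> is exactly what makes \<open>X (I + \<Psi>)\<close> a matrix
  solution of the perturbed system.\<close>

lemma perturbed_matrix_solution:
  fixes A B X P \<Psi> :: "real \<Rightarrow> real^'n^'n"
  assumes A: "continuous_on UNIV A" and X: "fundamental_matrix A X"
    and P: "P t = matrix_inv (X t) ** B t ** X t"
    and \<Psi>: "(\<Psi> has_vector_derivative P t ** (\<Psi> t + mat 1)) (at t)"
  shows "((\<lambda>t. X t ** (mat 1 + \<Psi> t)) has_vector_derivative
    (A t + B t) ** (X t ** (mat 1 + \<Psi> t))) (at t)"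
proof -
  have XP: "X t ** P t = B t ** X t"
    by (simp add: P matrix_mul_assoc fundamental_matrix_inverse [OF A X])
  have "((\<lambda>t. mat 1 + \<Psi> t) has_vector_derivative P t ** (mat 1 + \<Psi> t)) (at t)"
    using \<Psi> by (auto intro!: derivative_eq_intros simp: add.commute)
  moreover have "(X has_vector_derivative A t ** X t) (at t)"
    using X by (simp add: fundamental_matrix_def)
  ultimately have "((\<lambda>t. X t ** (mat 1 + \<Psi> t)) has_vector_derivative
      X t ** (P t ** (mat 1 + \<Psi> t)) + A t ** X t ** (mat 1 + \<Psi> t)) (at t)"
    by (intro bounded_bilinear.has_vector_derivative [OF bounded_bilinear_matrix_matrix_mult])
  also have "X t ** (P t ** (mat 1 + \<Psi> t)) = B t ** (X t ** (mat 1 + \<Psi> t))"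
    by (simp only: matrix_mul_assoc XP)
  finally show ?thesis
    by (simp add: bounded_bilinear.add_left [OF bounded_bilinear_matrix_matrix_mult]
        matrix_mul_assoc add.commute)
qed

lemma tendsto_matrix_vector_mult_zero:
  fixes M :: "'a \<Rightarrow> real^'n^'m"
  assumes "(M \<longlongrightarrow> 0) F"
  shows "((\<lambda>t. M t *v c) \<longlongrightarrow> 0) F"
  using bounded_bilinear.tendsto
    [OF bounded_bilinear_matrix_vector_mult assms tendsto_const [of c]] by simp

lemma solves_linear_system_continuous:
  assumes "solves_linear_system A x"
  shows "continuous_on UNIV x"
  using assms by (intro continuous_at_imp_continuous_on)
    (auto simp: solves_linear_system_def intro: has_vector_derivative_continuous)

text \<open>\<open>T\<close> carries a basis of \<open>V\<close> to a basis of the image. An isomorphism from the image to \<open>V\<close> is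
  the inverse of \<open>T\<close> on \<open>V\<close>, whose linearity uses that \<open>V\<close> is closed under the operations.\<close>

lemma k_dim_subspace_injective_image:
  assumes T: "Vector_Spaces.linear fun_scale fun_scale T"
    and V: "k_dim_subspace k V" and inj: "inj_on T V"
  shows "k_dim_subspace k (T ` V) \<and> linearly_isomorphic (T ` V) V"
proof
  interpret T: Vector_Spaces.linear fun_scale fun_scale T
    by (fact T)
  obtain b where b: "finite b" "card b = k" "fun_space.independent b" "fun_space.span b = V"
    using V unfolding k_dim_subspace_def by blast
  have "card (T ` b) = k"
    using b inj by (metis card_image fun_space.span_superset inj_on_subset)
  moreover have "fun_space.independent (T ` b)"
    using b inj by (intro T.independent_injective_image) auto
  ultimately show "k_dim_subspace k (T ` V)"
    unfolding k_dim_subspace_def using b T.span_image [of b] by blast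
  have sub: "fun_space.subspace V"
    using b(4) fun_space.subspace_span by blast
  have inv: "inv_into V T (T x) = x" if "x \<in> V" for x
    using that inj by simp
  show "linearly_isomorphic (T ` V) V"
    unfolding linearly_isomorphic_def
  proof (intro exI conjI ballI allI)
    show "bij_betw (inv_into V T) (T ` V) V"
      using inj by (simp add: bij_betw_inv_into inj_on_imp_bij_betw)
  next
    fix y z assume "y \<in> T ` V" "z \<in> T ` V"
    then show "inv_into V T (y + z) = inv_into V T y + inv_into V T z"
      using sub by (auto simp: inv fun_space.subspace_add simp flip: T.add)
  next
    fix c y assume "y \<in> T ` V"
    then show "inv_into V T (fun_scale c y) = fun_scale c (inv_into V T y)"
      using sub by (auto simp: inv fun_space.subspace_scale simp flip: T.scale)
  qed
qed

theorem corollary2p1: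
  fixes A B X P \<Psi> :: "real \<Rightarrow> real^'n^'n"
    and k :: nat
    and \<sigma>\<^sub>2 :: "(real \<Rightarrow> real^'n) set"
  assumes contA: "continuous_on UNIV A"
    and contB: "continuous_on UNIV B"
    and X: "fundamental_matrix A X"
    and P: "\<And>t. P t = matrix_inv (X t) ** B t ** X t"
    and P_int: "set_integrable lborel {0..} (\<lambda>t. onorm (\<lambda>v. P t *v v))"
    and \<Psi>: "\<And>t. (\<Psi> has_vector_derivative P t ** (\<Psi> t + mat 1)) (at t)"
    and \<Psi>_lim: "(\<Psi> \<longlongrightarrow> 0) at_top"
    and X\<Psi>_lim: "((\<lambda>t. X t ** \<Psi> t) \<longlongrightarrow> 0) at_top"
    and k: "k \<le> CARD('n)"
    and \<sigma>\<^sub>2: "k_parameter_family k A \<sigma>\<^sub>2"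
    and \<sigma>\<^sub>2_ap: "\<forall>x\<in>\<sigma>\<^sub>2. almost_periodic x"
  shows "\<exists>\<sigma>\<^sub>1. k_parameter_family k (\<lambda>t. A t + B t) \<sigma>\<^sub>1 \<and>
           (\<forall>y\<in>\<sigma>\<^sub>1. asymptotically_almost_periodic y) \<and>
           linearly_isomorphic \<sigma>\<^sub>1 \<sigma>\<^sub>2"
proof -
  define Y where "Y t = X t ** (mat 1 + \<Psi> t)" for t
  define T where "T x = (\<lambda>t. Y t *v x 0)" for x :: "real \<Rightarrow> real^'n"
  have dim: "k_dim_subspace k \<sigma>\<^sub>2" and sol: "\<And>x. x \<in> \<sigma>\<^sub>2 \<Longrightarrow> solves_linear_system A x"
    using \<sigma>\<^sub>2 by (auto simp: k_parameter_family_def)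
  have T_sol: "solves_linear_system (\<lambda>t. A t + B t) (T x)" for x
    unfolding T_def Y_def
    by (intro solves_linear_system_matrix_mult perturbed_matrix_solution [OF contA X P \<Psi>])
  have T_eq: "T x t = x t + (X t ** \<Psi> t) *v x 0" if "x \<in> \<sigma>\<^sub>2" for x t
    using solution_eq_fundamental_matrix_mult [OF contA X sol [OF that], of t]
    by (simp add: T_def Y_def matrix_add_ldistrib matrix_vector_mult_add_rdistrib)
  have linear: "Vector_Spaces.linear fun_scale fun_scale T"
    by unfold_locales
      (auto simp: T_def fun_scale_def fun_eq_iff matrix_vector_right_distrib
        matrix_vector_mult_scaleR)
  interpret T: Vector_Spaces.linear fun_scale fun_scale T
    by (fact linear)
  have ker: "x = 0" if "x \<in> \<sigma>\<^sub>2" and "T x = 0" for x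
  proof -
    have "X t *v ((mat 1 + \<Psi> t) *v x 0) = 0" for t
      using \<open>T x = 0\<close> by (simp add: T_def Y_def fun_eq_iff matrix_vector_mul_assoc)
    then have "x 0 + \<Psi> t *v x 0 = 0" for t
      using fundamental_matrix_mult_eq_zero_iff [OF contA X]
      by (simp add: matrix_vector_mult_add_rdistrib)
    moreover have "((\<lambda>t. x 0 + \<Psi> t *v x 0) \<longlongrightarrow> x 0 + 0) at_top"
      by (intro tendsto_intros tendsto_matrix_vector_mult_zero \<Psi>_lim)
    ultimately have "x 0 = 0"
      by (simp add: tendsto_const_iff)
    then show ?thesis
      using solves_linear_system_eq_zero [OF contA sol [OF that(1)]] by (auto simp: fun_eq_iff)
  qed
  have "fun_space.subspace \<sigma>\<^sub>2"
    using dim fun_space.subspace_span by (auto simp: k_dim_subspace_def)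
  then have inj: "inj_on T \<sigma>\<^sub>2"
    using ker by (subst T.inj_on_iff_eq_0) auto
  have aap: "asymptotically_almost_periodic (T x)" if "x \<in> \<sigma>\<^sub>2" for x
    unfolding asymptotically_almost_periodic_def
  proof (intro conjI exI allI)
    show T_cont: "continuous_on UNIV (T x)"
      using T_sol by (rule solves_linear_system_continuous)
    show "almost_periodic x"
      using \<sigma>\<^sub>2_ap that by blast
    show "((\<lambda>t. (X t ** \<Psi> t) *v x 0) \<longlongrightarrow> 0) at_top"
      by (intro tendsto_matrix_vector_mult_zero X\<Psi>_lim)
    have "continuous_on UNIV (\<lambda>t. T x t - x t)"
      by (intro continuous_on_diff T_cont solves_linear_system_continuous [OF sol [OF that]])
    then show "continuous_on UNIV (\<lambda>t. (X t ** \<Psi> t) *v x 0)"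
      by (simp add: T_eq [OF that])
  qed (rule T_eq [OF that])
  show ?thesis
    using k_dim_subspace_injective_image [OF linear dim inj] T_sol aap
    by (intro exI [where x = "T ` \<sigma>\<^sub>2"]) (auto simp: k_parameter_family_def)
qed

end
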